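(* We have $h(\alpha) = 5$ for every real $\alpha \geq 2$ and $h(\alpha) = 7$ for every $\alpha \in \left[\frac{1+\sqrt{5}}{2},2\right)$.
   Context: $\mathbb{N}_0=\{0,1,2,\dots\}$. For a real number $\alpha>1$, the exponential lattice is $L(\alpha)=\{\alpha^n \colon n \in \mathbb{N}_0\}^2=\{(\alpha^i,\alpha^j)\colon i,j\in\mathbb{N}_0\}\subseteq\mathbb{R}^2$. For a discrete set $S\subseteq\mathbb{R}^2$, a convex polygon $P$ with all vertices in $S$ is empty in $S$ if $P$ (including its boundary, in particular the interiors of its edges) contains no points of $S$ other than its vertices. $h(S)$ denotes the maximum number of vertices of an empty polygon in $S$, with $h(S)=\infty$ if there are empty polygons in $S$ with arbitrarily many vertices. $h(\alpha)$ abbreviates $h(L(\alpha))$. *)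

theory Defs
  imports "HOL-Analysis.Analysis" "HOL-Library.Extended_Nat"
begin

definition exp_lattice :: "real \<Rightarrow> (real \<times> real) set"
  where "exp_lattice \<alpha> = {\<alpha> ^ n | n :: nat. True} \<times> {\<alpha> ^ n | n :: nat. True}"

text \<open>Degenerate polygons (points and segments) are excluded by the dimension condition.\<close>

definition convex_polygon :: "(real \<times> real) set \<Rightarrow> bool"
  where "convex_polygon P \<longleftrightarrow> polytope P \<and> aff_dim P = 2"

definition vertices :: "(real \<times> real) set \<Rightarrow> (real \<times> real) set"
  where "vertices P = {v. v extreme_point_of P}"

text \<open>The polygon \<open>P\<close> is the closed region, so points of \<open>S\<close> on edges are excluded as well.\<close>

definition empty_polygon_in :: "(real \<times> real) set \<Rightarrow> (real \<times> real) set \<Rightarrow> bool"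
  where "empty_polygon_in S P \<longleftrightarrow>
    convex_polygon P \<and> vertices P \<subseteq> S \<and> P \<inter> S \<subseteq> vertices P"

text \<open>
  In \<^typ>\<open>enat\<close> the supremum of a bounded nonempty set is its maximum, and
  that of an unbounded set is \<open>\<infinity>\<close>; the supremum of the empty set is \<open>0\<close>.
  The cardinality is meaningful since a polytope has finitely many extreme points.
\<close>

definition h :: "(real \<times> real) set \<Rightarrow> enat"
  where "h S = Sup {enat (card (vertices P)) | P. empty_polygon_in S P}"

end

theory Submission
  imports Defs
begin

text \<open>
  Write lattice points by their exponents. The map \<open>(x, y) \<mapsto> (1/x, y/x)\<close> preserves the lattice (with
  integer exponents) and convexity in the positive quadrant; together with the reflection in the
  diagonal it permutes the three directions horizontal, vertical and diagonal of the exponent plane.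
  A strictly decreasing and a strictly increasing pair of vertices cannot share a vertex, as a
  neighbouring lattice point would lie in the triangle. Hence up to these symmetries a polygon with at
  least five vertices has no strictly increasing pair. Then every vertex lies on the
  upper right or the lower left chain. If \<open>\<alpha> ^ K * (\<alpha> - 1) \<ge> \<alpha>\<close>, convexity bounds the former by
  \<open>K + 1\<close> vertices, and emptiness bounds the latter by \<open>K + 2\<close>. So \<open>h(\<alpha>) \<le> 2 * K + 3\<close>, where \<open>K = 1\<close> works for
  \<open>\<alpha> \<ge> 2\<close> and \<open>K = 2\<close> for \<open>\<alpha>\<close> at least the golden ratio. Explicit polygons attain the bounds.
\<close>

section \<open>Separation in the exponent plane and its symmetries\<close>

text \<open>
  \<open>V\<close> consists of exponents. For points of \<open>V\<close> the separation condition expresses convex position, and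
  for the other points emptiness.
\<close>

definition good :: "real \<Rightarrow> (int \<times> int) set \<Rightarrow> bool"
  where "good \<alpha> V \<longleftrightarrow> (\<forall>i j. \<exists>a b c. a * \<alpha> powi i + b * \<alpha> powi j + c > 0 \<and>
    (\<forall>(k, l) \<in> V - {(i, j)}. a * \<alpha> powi k + b * \<alpha> powi l + c \<le> 0))"

lemma goodE:
  assumes "good \<alpha> V"
  obtains a b c where "a * \<alpha> powi i + b * \<alpha> powi j + c > 0"
    "\<And>k l. (k, l) \<in> V \<Longrightarrow> (k, l) \<noteq> (i, j) \<Longrightarrow> a * \<alpha> powi k + b * \<alpha> powi l + c \<le> 0"
proof -
  from assms obtain a b c where "a * \<alpha> powi i + b * \<alpha> powi j + c > 0"
    and *: "\<forall>(k, l) \<in> V - {(i, j)}. a * \<alpha> powi k + b * \<alpha> powi l + c \<le> 0"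
    unfolding good_def by blast
  then show ?thesis by (intro that[of a b c]) auto
qed

lemma goodI:
  assumes "\<And>i j. \<exists>a b c. a * \<alpha> powi i + b * \<alpha> powi j + c > 0 \<and>
    (\<forall>k l. (k, l) \<in> V \<longrightarrow> (k, l) \<noteq> (i, j) \<longrightarrow> a * \<alpha> powi k + b * \<alpha> powi l + c \<le> 0)"
  shows "good \<alpha> V"
  unfolding good_def using assms by (simp add: Ball_def imp_conjL)

lemma good_swap:
  assumes "good \<alpha> V"
  shows "good \<alpha> (prod.swap ` V)"
proof (rule goodI)
  fix i j
  obtain a b c where *: "a * \<alpha> powi j + b * \<alpha> powi i + c > 0"
    "\<And>k l. (k, l) \<in> V \<Longrightarrow> (k, l) \<noteq> (j, i) \<Longrightarrow> a * \<alpha> powi k + b * \<alpha> powi l + c \<le> 0"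
    using goodE[OF assms] by blast
  show "\<exists>a b c. a * \<alpha> powi i + b * \<alpha> powi j + c > 0 \<and>
    (\<forall>k l. (k, l) \<in> prod.swap ` V \<longrightarrow> (k, l) \<noteq> (i, j) \<longrightarrow> a * \<alpha> powi k + b * \<alpha> powi l + c \<le> 0)"
    by (rule exI[of _ b], rule exI[of _ a], rule exI[of _ c]) (use * in \<open>auto simp: add.commute\<close>)
qed

text \<open>
  Exchanging the first and the last homogeneous coordinate of \<open>(\<alpha>\<^sup>i : \<alpha>\<^sup>j : 1)\<close>. An affine functional
  stays one after multiplication by a positive factor, so separation is preserved.
\<close>

definition proj_swap :: "int \<times> int \<Rightarrow> int \<times> int"
  where "proj_swap p = (- fst p, snd p - fst p)"

lemma inj_proj_swap: "inj proj_swap"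
  by (auto simp: inj_def proj_swap_def prod_eq_iff)

locale exp_base =
  fixes \<alpha> :: real
  assumes base_gt_1: "\<alpha> > 1"
begin

lemma powi_pos: "\<alpha> powi i > 0"
  using base_gt_1 by simp

lemma powi_mono: "i \<le> j \<Longrightarrow> \<alpha> powi i \<le> \<alpha> powi j"
  using base_gt_1 by (intro power_int_increasing) auto

lemma powi_less: "i < j \<Longrightarrow> \<alpha> powi i < \<alpha> powi j"
  using base_gt_1 by (intro power_int_strict_increasing) auto

lemma powi_Suc: "\<alpha> powi (i + 1) = \<alpha> * \<alpha> powi i"
  using base_gt_1 by (simp add: power_int_add)

text \<open>\<open>proj_swap\<close> is an involution, so \<open>(i, j)\<close> is the image of
  \<open>(-i, j - i)\<close>. Multiplying the functional with coefficients \<open>a\<close>,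
  \<open>b\<close>, \<open>c\<close> at that preimage by the positive number
  \<open>\<alpha> powi i\<close> gives, at \<open>(i, j)\<close>, the functional with
  \<open>a\<close> and \<open>c\<close> exchanged; the sign is kept.\<close>

lemma good_proj_swap:
  assumes "good \<alpha> V"
  shows "good \<alpha> (proj_swap ` V)"
proof (rule goodI)
  fix i j
  obtain a b c where *: "a * \<alpha> powi (-i) + b * \<alpha> powi (j - i) + c > 0"
    "\<And>k l. (k, l) \<in> V \<Longrightarrow> (k, l) \<noteq> (-i, j - i) \<Longrightarrow> a * \<alpha> powi k + b * \<alpha> powi l + c \<le> 0"
    using goodE[OF assms] by blast
  have scale: "\<alpha> powi k * (a * \<alpha> powi (-k) + b * \<alpha> powi (l - k) + c) =
      c * \<alpha> powi k + b * \<alpha> powi l + a" for k l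
    using base_gt_1 by (simp add: power_int_diff power_int_minus field_simps)
  have "c * \<alpha> powi i + b * \<alpha> powi j + a > 0"
    using mult_pos_pos[OF powi_pos[of i] *(1)] scale by simp
  moreover have "c * \<alpha> powi k + b * \<alpha> powi l + a \<le> 0"
    if kl: "(k, l) \<in> proj_swap ` V" "(k, l) \<noteq> (i, j)" for k l
  proof -
    have "(-k, l - k) \<in> V"
      using kl(1) by (auto simp: proj_swap_def)
    then have "a * \<alpha> powi (-k) + b * \<alpha> powi (l - k) + c \<le> 0"
      using kl(2) by (intro *(2)) auto
    then have "\<alpha> powi k * (a * \<alpha> powi (-k) + b * \<alpha> powi (l - k) + c) \<le> 0"
      by (intro mult_nonneg_nonpos less_imp_le[OF powi_pos])
    then show ?thesis by (simp only: scale)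
  qed
  ultimately show "\<exists>a b c. a * \<alpha> powi i + b * \<alpha> powi j + c > 0 \<and>
    (\<forall>k l. (k, l) \<in> proj_swap ` V \<longrightarrow> (k, l) \<noteq> (i, j) \<longrightarrow> a * \<alpha> powi k + b * \<alpha> powi l + c \<le> 0)"
    by blast
qed

section \<open>Forbidden configurations of vertices\<close>

lemma between_neg:
  assumes "a * x1 + d \<le> 0" "a * x2 + d \<le> 0" "x1 \<le> x" "x \<le> (x2::real)"
  shows "a * x + d \<le> 0"
proof (cases "a \<ge> 0")
  case True
  then show ?thesis using assms mult_left_mono[of x x2 a] by linarith
next
  case False
  then show ?thesis using assms mult_left_mono_neg[of x1 x a] by linarith
qed

text \<open>The point \<open>(i, j + 1)\<close> would lie in the triangle of the three vertices: a
  functional that is positive there and nonpositive at \<open>(i, j)\<close> has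
  \<open>b > 0\<close>, so lowering the other two vertices to row \<open>j + 1\<close> keeps it
  nonpositive, and \<open>(i, j + 1)\<close> lies between the lowered points.\<close>

lemma good_no_up:
  assumes "good \<alpha> V" "(i, j) \<in> V" "(i1, j1) \<in> V" "(i2, j2) \<in> V"
    and "i1 < i" "i < i2" "j < j1" "j < j2"
  shows False
proof -
  obtain a b c where *: "a * \<alpha> powi i + b * \<alpha> powi (j + 1) + c > 0"
    "\<And>k l. (k, l) \<in> V \<Longrightarrow> (k, l) \<noteq> (i, j + 1) \<Longrightarrow> a * \<alpha> powi k + b * \<alpha> powi l + c \<le> 0"
    using goodE[OF assms(1)] by blast
  have q: "a * \<alpha> powi i + b * \<alpha> powi j + c \<le> 0"
    and p: "a * \<alpha> powi i1 + b * \<alpha> powi j1 + c \<le> 0"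
    and r: "a * \<alpha> powi i2 + b * \<alpha> powi j2 + c \<le> 0"
    using assms by (auto intro!: *(2))
  have "b * (\<alpha> powi (j + 1) - \<alpha> powi j) > 0"
    using q *(1) by (simp add: algebra_simps)
  then have b: "b > 0"
    using powi_less[of j "j + 1"] by (simp add: zero_less_mult_iff)
  have "b * \<alpha> powi (j + 1) \<le> b * \<alpha> powi j1" "b * \<alpha> powi (j + 1) \<le> b * \<alpha> powi j2"
    using assms b by (simp_all add: powi_mono)
  then have "a * \<alpha> powi i + (b * \<alpha> powi (j + 1) + c) \<le> 0"
    using p r powi_mono[of i1 i] powi_mono[of i i2] assms(5,6)
    by (auto intro: between_neg[of a "\<alpha> powi i1" _ "\<alpha> powi i2"])
  then show False using *(1) by simp
qed

text \<open>The argument of \<open>good_no_up\<close> upside down, with the point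
  \<open>(i, j - 1)\<close> and \<open>b < 0\<close>.\<close>

lemma good_no_down:
  assumes "good \<alpha> V" "(i, j) \<in> V" "(i1, j1) \<in> V" "(i2, j2) \<in> V"
    and "i1 < i" "i < i2" "j1 < j" "j2 < j"
  shows False
proof -
  obtain a b c where *: "a * \<alpha> powi i + b * \<alpha> powi (j - 1) + c > 0"
    "\<And>k l. (k, l) \<in> V \<Longrightarrow> (k, l) \<noteq> (i, j - 1) \<Longrightarrow> a * \<alpha> powi k + b * \<alpha> powi l + c \<le> 0"
    using goodE[OF assms(1)] by blast
  have q: "a * \<alpha> powi i + b * \<alpha> powi j + c \<le> 0"
    and p: "a * \<alpha> powi i1 + b * \<alpha> powi j1 + c \<le> 0"
    and r: "a * \<alpha> powi i2 + b * \<alpha> powi j2 + c \<le> 0"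
    using assms by (auto intro!: *(2))
  have "b * (\<alpha> powi j - \<alpha> powi (j - 1)) < 0"
    using q *(1) by (simp add: algebra_simps)
  then have b: "b < 0"
    using powi_less[of "j - 1" j] by (simp add: mult_less_0_iff)
  have "b * \<alpha> powi (j - 1) \<le> b * \<alpha> powi j1" "b * \<alpha> powi (j - 1) \<le> b * \<alpha> powi j2"
    using assms b by (simp_all add: powi_mono)
  then have "a * \<alpha> powi i + (b * \<alpha> powi (j - 1) + c) \<le> 0"
    using p r powi_mono[of i1 i] powi_mono[of i i2] assms(5,6)
    by (auto intro: between_neg[of a "\<alpha> powi i1" _ "\<alpha> powi i2"])
  then show False using *(1) by simp
qed

lemma good_no_left:
  assumes "good \<alpha> V" "(i, j) \<in> V" "(i1, j1) \<in> V" "(i2, j2) \<in> V"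
    and "i1 < i" "i2 < i" "j1 < j" "j < j2"
  shows False
proof (rule good_no_down[OF good_swap[OF assms(1)]])
  show "(j, i) \<in> prod.swap ` V" "(j1, i1) \<in> prod.swap ` V" "(j2, i2) \<in> prod.swap ` V"
    using assms(2-4) by simp_all
qed (use assms in auto)

lemma good_no_right:
  assumes "good \<alpha> V" "(i, j) \<in> V" "(i1, j1) \<in> V" "(i2, j2) \<in> V"
    and "i < i1" "i < i2" "j1 < j" "j < j2"
  shows False
proof (rule good_no_up[OF good_swap[OF assms(1)]])
  show "(j, i) \<in> prod.swap ` V" "(j1, i1) \<in> prod.swap ` V" "(j2, i2) \<in> prod.swap ` V"
    using assms(2-4) by simp_all
qed (use assms in auto)

lemma good_row:
  assumes "good \<alpha> V" "(i, j) \<in> V" "(i1, j) \<in> V" "(i2, j) \<in> V" "i1 < i" "i < i2"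
  shows False
proof -
  obtain a b c where *: "a * \<alpha> powi i + b * \<alpha> powi j + c > 0"
    "\<And>k l. (k, l) \<in> V \<Longrightarrow> (k, l) \<noteq> (i, j) \<Longrightarrow> a * \<alpha> powi k + b * \<alpha> powi l + c \<le> 0"
    using goodE[OF assms(1)] by blast
  have "a * \<alpha> powi i1 + b * \<alpha> powi j + c \<le> 0" "a * \<alpha> powi i2 + b * \<alpha> powi j + c \<le> 0"
    using assms by (auto intro!: *(2))
  then have "a * \<alpha> powi i + (b * \<alpha> powi j + c) \<le> 0"
    using powi_mono[of i1 i] powi_mono[of i i2] assms(5,6)
    by (auto intro: between_neg[of a "\<alpha> powi i1" _ "\<alpha> powi i2"])
  then show False using *(1) by simp
qed

lemma good_row_unique:
  assumes "good \<alpha> V" "p \<in> V" "q \<in> V" "r \<in> V" "snd q = snd p" "snd r = snd p"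
    and "q \<noteq> p" "r \<noteq> p"
  shows "q = r"
proof (rule ccontr)
  assume "q \<noteq> r"
  obtain i1 i2 i3 j where [simp]: "p = (i1, j)" "q = (i2, j)" "r = (i3, j)"
    using assms by (cases p; cases q; cases r) auto
  have "i1 \<noteq> i2" "i2 \<noteq> i3" "i1 \<noteq> i3" using assms \<open>q \<noteq> r\<close> by auto
  then consider "i1 < i2" "i2 < i3" | "i1 < i3" "i3 < i2" | "i2 < i1" "i1 < i3"
    | "i2 < i3" "i3 < i1" | "i3 < i1" "i1 < i2" | "i3 < i2" "i2 < i1"
    by linarith
  then show False using assms(1-4) good_row[OF assms(1)] by cases auto
qed

lemma good_col_unique:
  assumes "good \<alpha> V" "p \<in> V" "q \<in> V" "r \<in> V" "fst q = fst p" "fst r = fst p"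
    and "q \<noteq> p" "r \<noteq> p"
  shows "q = r"
proof -
  have "prod.swap q = prod.swap r"
    by (rule good_row_unique[OF good_swap[OF assms(1)], of "prod.swap p"])
      (use assms in \<open>simp_all add: inj_eq[OF inj_swap]\<close>)
  then show ?thesis by (simp add: inj_eq[OF inj_swap])
qed

text \<open>Since \<open>snd (proj_swap p) = snd p - fst p\<close>, diagonals become rows under
  \<open>proj_swap\<close>.\<close>

lemma good_diag_unique:
  assumes "good \<alpha> V" "p \<in> V" "q \<in> V" "r \<in> V"
    and "snd q - fst q = snd p - fst p" "snd r - fst r = snd p - fst p"
    and "q \<noteq> p" "r \<noteq> p"
  shows "q = r"
proof -
  have "proj_swap q = proj_swap r"
    by (rule good_row_unique[OF good_proj_swap[OF assms(1)], of "proj_swap p"])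
      (use assms inj_proj_swap in \<open>simp_all add: inj_eq\<close>, simp_all add: proj_swap_def)
  then show ?thesis using inj_proj_swap by (simp add: inj_eq)
qed

section \<open>Decreasing and increasing pairs of vertices\<close>

definition anti_pair :: "int \<times> int \<Rightarrow> int \<times> int \<Rightarrow> bool"
  where "anti_pair p q \<longleftrightarrow> fst p < fst q \<and> snd q < snd p \<or> fst q < fst p \<and> snd p < snd q"

definition iso_pair :: "int \<times> int \<Rightarrow> int \<times> int \<Rightarrow> bool"
  where "iso_pair p q \<longleftrightarrow> fst p < fst q \<and> snd p < snd q \<or> fst q < fst p \<and> snd q < snd p"

text \<open>Seen from \<open>q\<close>, the point \<open>p\<close> is in the upper left or lower
  right quadrant and \<open>r\<close> in the upper right or lower left one. These quadrants are
  adjacent, so both points lie strictly above, below, to the left or to the right of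
  \<open>q\<close>, which is one of the four forbidden configurations.\<close>

lemma good_anti_iso:
  assumes "good \<alpha> V" "q \<in> V" "p \<in> V" "r \<in> V" "anti_pair p q" "iso_pair q r"
  shows False
proof -
  obtain i j i1 j1 i2 j2 where [simp]: "q = (i, j)" "p = (i1, j1)" "r = (i2, j2)"
    by (cases p; cases q; cases r) auto
  note V = assms(2-4)[simplified]
  from assms(5,6) consider "i1 < i" "j < j1" "i < i2" "j < j2" | "i1 < i" "j < j1" "i2 < i" "j2 < j"
    | "i < i1" "j1 < j" "i < i2" "j < j2" | "i < i1" "j1 < j" "i2 < i" "j2 < j"
    unfolding anti_pair_def iso_pair_def by auto
  then show False
  proof cases
    case 1 then show ?thesis using good_no_up[OF assms(1) V] by blast
  next
    case 2 then show ?thesis using good_no_left[OF assms(1) V(1,3,2)] by blast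
  next
    case 3 then show ?thesis using good_no_right[OF assms(1) V] by blast
  next
    case 4 then show ?thesis using good_no_down[OF assms(1) V(1,3,2)] by blast
  qed
qed

text \<open>Members of decreasing pairs (\<open>A\<close>) and of increasing pairs
  (\<open>M\<close>) form disjoint sets, so each element of \<open>A\<close> shares a row or column
  with each element of \<open>M\<close>. Hence \<open>r\<close> and \<open>s\<close> complete
  \<open>p\<close> and \<open>q\<close> to the corners of an axis-parallel rectangle, and every
  further vertex turns out to be a corner too.\<close>

lemma card_anti_iso:
  assumes V: "good \<alpha> V" and pq: "p \<in> V" "q \<in> V" "anti_pair p q" and rs: "r \<in> V" "s \<in> V" "iso_pair r s"
  shows "card V \<le> 4"
proof -
  define A where "A = {x \<in> V. \<exists>y\<in>V. anti_pair x y}"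
  define M where "M = {x \<in> V. \<exists>y\<in>V. iso_pair x y}"
  have sym: "anti_pair y x" if "anti_pair x y" for x y
    using that by (auto simp: anti_pair_def)
  have sym': "iso_pair y x" if "iso_pair x y" for x y
    using that by (auto simp: iso_pair_def)
  have disj: "A \<inter> M = {}"
    using good_anti_iso[OF V] sym unfolding A_def M_def by blast
  have axis: "fst x = fst y \<or> snd x = snd y" if "\<not> anti_pair x y" "\<not> iso_pair x y" for x y
    using that by (auto simp: anti_pair_def iso_pair_def)
  have A: "x \<in> A \<and> y \<in> A" if "x \<in> V" "y \<in> V" "anti_pair x y" for x y
    using that sym unfolding A_def by blast
  have M: "x \<in> M \<and> y \<in> M" if "x \<in> V" "y \<in> V" "iso_pair x y" for x y
    using that sym' unfolding M_def by blast
  have V_sub: "x \<in> V" if "x \<in> A \<or> x \<in> M" for x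
    using that unfolding A_def M_def by blast
  have cross: "fst x = fst z \<or> snd x = snd z" if "x \<in> A" "z \<in> M" for x z
  proof (rule axis)
    show "\<not> anti_pair x z" "\<not> iso_pair x z"
      using A[of x z] M[of x z] V_sub[of x] V_sub[of z] that disj by blast+
  qed
  have pq': "p \<in> A" "q \<in> A" and rs': "r \<in> M" "s \<in> M"
    using A[OF pq] M[OF rs] by auto
  note 1 = cross[OF pq'(1) rs'(1)] cross[OF pq'(1) rs'(2)]
    cross[OF pq'(2) rs'(1)] cross[OF pq'(2) rs'(2)]
  have "t \<in> {p, q, r, s}" if t: "t \<in> V" for t
  proof -
    consider "t \<in> A" | "t \<in> M" | "t \<notin> A" "t \<notin> M" by blast
    \<comment> \<open>In every case \<open>t\<close> shares a row or column with both ends of one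
      diagonal of the rectangle, which makes it a corner.\<close>
    then have 2: "(fst t = fst r \<or> snd t = snd r) \<and> (fst t = fst s \<or> snd t = snd s) \<or>
      (fst p = fst t \<or> snd p = snd t) \<and> (fst q = fst t \<or> snd q = snd t)"
    proof cases
      case 1 then show ?thesis using cross rs' by blast
    next
      case 2 then show ?thesis using cross pq' by blast
    next
      case 3
      then have "fst t = fst y \<or> snd t = snd y" if "y \<in> V" for y
        using A[OF t that] M[OF t that] axis by blast
      then show ?thesis using rs by blast
    qed
    have "fst p \<noteq> fst q" "snd p \<noteq> snd q" "fst r \<noteq> fst s" "snd r \<noteq> snd s"
      using pq(3) rs(3) by (auto simp: anti_pair_def iso_pair_def)
    then have "fst t = fst p \<and> snd t = snd p \<or> fst t = fst q \<and> snd t = snd q \<or>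
      fst t = fst r \<and> snd t = snd r \<or> fst t = fst s \<and> snd t = snd s"
      using 1 2 by metis
    then show ?thesis by (auto simp: prod_eq_iff)
  qed
  then have "card V \<le> card {p, q, r, s}"
    by (intro card_mono) auto
  also have "\<dots> \<le> 4" by (auto simp: card_insert_if)
  finally show ?thesis .
qed

text \<open>Here \<open>a\<close> and \<open>b\<close> are the two smallest elements and
  \<open>c\<close> is the largest: the at least \<open>m + 1\<close> elements other than
  \<open>a\<close> fit into \<open>{b..c}\<close>.\<close>

lemma int_set_gap:
  fixes A :: "int set"
  assumes "finite A" "card A \<ge> m + 2" "m \<ge> 1"
  shows "\<exists>a\<in>A. \<exists>b\<in>A. \<exists>c\<in>A. a < b \<and> b + int m \<le> c"
proof -
  have ne: "A \<noteq> {}" using assms by auto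
  define a where "a = Min A"
  define c where "c = Max A"
  define b where "b = Min (A - {a})"
  have a: "a \<in> A" and c: "c \<in> A"
    using ne assms(1) unfolding a_def c_def by auto
  have card': "card (A - {a}) \<ge> m + 1"
    using assms(2) a by (simp add: assms(1))
  then have ne': "A - {a} \<noteq> {}" by (metis card.empty le_zero_eq add_is_0 one_neq_zero)
  have b: "b \<in> A - {a}"
    unfolding b_def using ne' assms(1) by (intro Min_in) auto
  have "a \<le> b" using b assms(1) unfolding a_def by auto
  then have "a < b" using b by auto
  have "A - {a} \<subseteq> {b..c}"
  proof
    fix x assume x: "x \<in> A - {a}"
    then have "b \<le> x" unfolding b_def using assms(1) by (intro Min_le) auto
    moreover have "x \<le> c" unfolding c_def using x assms(1) by auto
    ultimately show "x \<in> {b..c}" by simp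
  qed
  then have "card (A - {a}) \<le> card {b..c}"
    by (intro card_mono) auto
  then have "int m \<le> c - b"
    using card' by simp
  then have "b + int m \<le> c" by simp
  then show ?thesis using a b c \<open>a < b\<close> by blast
qed

end

section \<open>Size bounds for the upper right and lower left chains\<close>

locale exp_chain = exp_base +
  fixes K :: nat
  assumes K: "\<alpha> \<le> \<alpha> ^ K * (\<alpha> - 1)"
begin

lemma K_pos: "K > 0"
  using K by (cases K) auto

lemma powi_gap:
  assumes "j + int n \<le> i"
  shows "\<alpha> ^ n * \<alpha> powi j \<le> \<alpha> powi i"
proof -
  have "\<alpha> ^ n * \<alpha> powi j = \<alpha> powi (j + int n)"
    using base_gt_1 by (simp add: power_int_add)
  also have "\<dots> \<le> \<alpha> powi i" using assms by (rule powi_mono)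
  finally show ?thesis .
qed

text \<open>The assumption \<open>turn\<close> places the middle vertex above the chord of the outer
  two. With \<open>K + 2\<close> vertices, the second and the last column are at least
  \<open>K\<close> apart; then the left side of \<open>turn\<close> is at least
  \<open>\<alpha> powi i * \<alpha> powi j\<close>, while the right side never exceeds this
  product.\<close>

lemma upper_chain_card:
  assumes fin: "finite W"
    and anti: "\<And>p q. p \<in> W \<Longrightarrow> q \<in> W \<Longrightarrow> p \<noteq> q \<Longrightarrow> anti_pair p q"
    and turn: "\<And>i1 j1 i j i2 j2. (i1, j1) \<in> W \<Longrightarrow> (i, j) \<in> W \<Longrightarrow> (i2, j2) \<in> W \<Longrightarrow>
      i1 < i \<Longrightarrow> i < i2 \<Longrightarrow> j2 < j \<Longrightarrow> j < j1 \<Longrightarrow>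
      (\<alpha> powi j1 - \<alpha> powi j) * (\<alpha> powi i2 - \<alpha> powi i) <
      (\<alpha> powi i - \<alpha> powi i1) * (\<alpha> powi j - \<alpha> powi j2)"
  shows "card W \<le> K + 1"
proof (rule ccontr)
  assume "\<not> card W \<le> K + 1"
  moreover have "inj_on fst W"
    using anti by (force simp: inj_on_def anti_pair_def)
  ultimately have "card (fst ` W) \<ge> K + 2"
    by (simp add: card_image)
  then obtain i1 i i2 where "i1 \<in> fst ` W" "i \<in> fst ` W" "i2 \<in> fst ` W" "i1 < i"
    and gap: "i + int K \<le> i2"
    using int_set_gap[of "fst ` W" K] fin K_pos by fastforce
  then obtain j1 j j2 where W: "(i1, j1) \<in> W" "(i, j) \<in> W" "(i2, j2) \<in> W"
    by auto
  have "i < i2" using gap K_pos by simp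
  have j: "j2 < j" "j < j1"
    using anti[OF W(1,2)] anti[OF W(2,3)] \<open>i1 < i\<close> \<open>i < i2\<close> by (auto simp: anti_pair_def)
  have x: "(\<alpha> ^ K - 1) * \<alpha> powi i \<le> \<alpha> powi i2 - \<alpha> powi i"
    using powi_gap[OF gap] by (simp add: algebra_simps)
  have y: "(\<alpha> - 1) * \<alpha> powi j \<le> \<alpha> powi j1 - \<alpha> powi j"
    using powi_gap[of j 1 j1] j by (simp add: algebra_simps)
  \<comment> \<open>The assumption \<open>K\<close> rearranges to
    \<open>(\<alpha> ^ K - 1) * (\<alpha> - 1) \<ge> 1\<close>.\<close>
  have "\<alpha> powi i * \<alpha> powi j \<le> ((\<alpha> ^ K - 1) * (\<alpha> - 1)) * (\<alpha> powi i * \<alpha> powi j)"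
    using K mult_right_mono[of 1 "(\<alpha> ^ K - 1) * (\<alpha> - 1)" "\<alpha> powi i * \<alpha> powi j"]
      powi_pos[of i] powi_pos[of j] by (simp add: algebra_simps)
  also have "\<dots> = ((\<alpha> - 1) * \<alpha> powi j) * ((\<alpha> ^ K - 1) * \<alpha> powi i)"
    by (simp only: mult_ac)
  also have "\<dots> \<le> (\<alpha> powi j1 - \<alpha> powi j) * (\<alpha> powi i2 - \<alpha> powi i)"
    using base_gt_1 powi_less[OF j(2)] by (intro mult_mono x y) auto
  also have "\<dots> < (\<alpha> powi i - \<alpha> powi i1) * (\<alpha> powi j - \<alpha> powi j2)"
    using turn[OF W] \<open>i1 < i\<close> \<open>i < i2\<close> j by simp
  also have "\<dots> \<le> \<alpha> powi i * \<alpha> powi j"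
    using powi_less[OF j(1)] powi_pos[of i1] powi_pos[of j2] powi_pos[of i]
    by (intro mult_mono) auto
  finally show False by simp
qed

text \<open>By emptiness the right neighbour \<open>(i + 1, j)\<close> of the middle vertex must lie
  strictly above the chord of the outer two. If \<open>i2\<close> exceeded \<open>i + K\<close>, the
  chord would be too flat for this.\<close>

lemma good_lower_turn:
  assumes good: "good \<alpha> V" and V: "(i1, j1) \<in> V" "(i, j) \<in> V" "(i2, j2) \<in> V"
    and ord: "i1 < i" "i < i2" "j2 < j" "j < j1"
    and turn: "(\<alpha> powi i - \<alpha> powi i1) * (\<alpha> powi j - \<alpha> powi j2) <
      (\<alpha> powi j1 - \<alpha> powi j) * (\<alpha> powi i2 - \<alpha> powi i)"
  shows "i2 \<le> i + int K"
proof (rule ccontr)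
  assume "\<not> i2 \<le> i + int K"
  then have gap: "i + int (Suc K) \<le> i2" by simp
  define x1 x x2 y1 y y2 where defs: "x1 = \<alpha> powi i1" "x = \<alpha> powi i" "x2 = \<alpha> powi i2"
    "y1 = \<alpha> powi j1" "y = \<alpha> powi j" "y2 = \<alpha> powi j2"
  have pos: "x1 > 0" "x > 0" "x2 > 0" "y1 > 0" "y > 0" "y2 > 0"
    unfolding defs by (rule powi_pos)+
  have less: "x1 < x" "x < x2" "y2 < y" "y < y1"
    unfolding defs using ord by (auto intro: powi_less)
  obtain a b c where f: "a * (\<alpha> * x) + b * y + c > 0"
    "\<And>k l. (k, l) \<in> V \<Longrightarrow> (k, l) \<noteq> (i + 1, j) \<Longrightarrow> a * \<alpha> powi k + b * \<alpha> powi l + c \<le> 0"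
    using goodE[OF good, of "i + 1" j] unfolding defs powi_Suc by blast
  have f1: "a * x1 + b * y1 + c \<le> 0" and f0: "a * x + b * y + c \<le> 0" and f2: "a * x2 + b * y2 + c \<le> 0"
    using f(2)[OF V(1)] f(2)[OF V(2)] f(2)[OF V(3)] ord unfolding defs by auto
  \<comment> \<open>The line through the outer vertices is \<open>A * X + B * Y = C\<close>; as
    \<open>A\<close> and \<open>B\<close> are positive, larger values mean above it.\<close>
  define A B C where ABC: "A = y1 - y2" "B = x2 - x1" "C = A * x1 + B * y1"
  have AB: "A > 0" "B > 0" using less unfolding ABC by auto
  have C2: "C = A * x2 + B * y2" unfolding ABC by (simp add: algebra_simps)
  have above: "A * (\<alpha> * x) + B * y > C"
  proof (rule ccontr)
    assume not_above: "\<not> A * (\<alpha> * x) + B * y > C"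
    define t where "t = \<alpha> * x"
    have le: "A * t + B * y \<le> C" using not_above unfolding t_def by simp
    have "a * (\<alpha> - 1) * x > 0" using f(1) f0 by (simp add: algebra_simps)
    then have a: "a > 0" using base_gt_1 pos by (simp add: zero_less_mult_iff)
    \<comment> \<open>the horizontal line through \<open>(t, y)\<close> meets the chord at a point that is not to the left of \<open>(t, y)\<close>\<close>
    have "A * (a * t + b * y + c) \<le> a * (C - B * y) + A * (b * y + c)"
    proof -
      have "a * (A * t) \<le> a * (C - B * y)" using le a by (intro mult_left_mono) auto
      then show ?thesis by (simp add: algebra_simps)
    qed
    also have "\<dots> = (y - y2) * (a * x1 + b * y1 + c) + (y1 - y) * (a * x2 + b * y2 + c)"
      unfolding ABC by (simp add: algebra_simps)
    also have "\<dots> \<le> 0"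
      using mult_nonneg_nonpos[OF _ f1, of "y - y2"] mult_nonneg_nonpos[OF _ f2, of "y1 - y"] less
      by simp
    finally have "a * t + b * y + c \<le> 0"
      using AB by (simp add: mult_le_0_iff)
    then show False using f(1) unfolding t_def by simp
  qed
  \<comment> \<open>Each end of the chord bounds one term of its equation: the left end gives
    \<open>By\<close>, and the right end together with the gap gives \<open>Ax\<close>.\<close>
  have "\<alpha> * y \<le> y1"
    using powi_gap[of j 1 j1] ord unfolding defs by simp
  then have "B * (\<alpha> * y) \<le> B * y1" using AB by (intro mult_left_mono) auto
  then have By: "\<alpha> * (B * y) < C"
    using mult_pos_pos[OF AB(1) pos(1)] unfolding ABC(3) by (simp add: mult_ac)
  have "\<alpha> ^ Suc K * x \<le> x2"
    using powi_gap[OF gap] unfolding defs by simp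
  then have "A * (\<alpha> ^ Suc K * x) \<le> A * x2" using AB by (intro mult_left_mono) auto
  then have Ax: "\<alpha> ^ Suc K * (A * x) < C"
    using mult_pos_pos[OF AB(2) pos(6)] unfolding C2 by (simp add: mult_ac)
  have Ax_pos: "A * x > 0" using AB pos by simp
  \<comment> \<open>\<open>above\<close> and \<open>By\<close> bound \<open>C\<close> from above by
    a multiple of \<open>A * x\<close>, whereas \<open>Ax\<close> bounds it from below; the
    assumption \<open>K\<close> makes the two bounds incompatible.\<close>
  have "(\<alpha> - 1) * C < \<alpha> * \<alpha> * (A * x)"
  proof -
    have "\<alpha> * C < \<alpha> * (A * (\<alpha> * x) + B * y)" using above base_gt_1 by simp
    then show ?thesis using By by (simp add: algebra_simps)
  qed
  moreover have "(\<alpha> - 1) * (\<alpha> ^ Suc K * (A * x)) < (\<alpha> - 1) * C"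
    using Ax base_gt_1 by simp
  moreover have "\<alpha> * \<alpha> * (A * x) \<le> (\<alpha> - 1) * (\<alpha> ^ Suc K * (A * x))"
  proof -
    have "\<alpha> * (A * x) * \<alpha> \<le> \<alpha> * (A * x) * (\<alpha> ^ K * (\<alpha> - 1))"
      using K Ax_pos base_gt_1 by (intro mult_left_mono) auto
    then show ?thesis by (simp add: mult_ac)
  qed
  ultimately show False by linarith
qed

text \<open>The same choice of three vertices as in \<open>upper_chain_card\<close>; as
  \<open>good_lower_turn\<close> only excludes a gap of \<open>K + 1\<close> columns, the bound is
  larger by one.\<close>

lemma lower_chain_card:
  assumes good: "good \<alpha> V" and fin: "finite W" and sub: "W \<subseteq> V"
    and anti: "\<And>p q. p \<in> W \<Longrightarrow> q \<in> W \<Longrightarrow> p \<noteq> q \<Longrightarrow> anti_pair p q"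
    and turn: "\<And>i1 j1 i j i2 j2. (i1, j1) \<in> W \<Longrightarrow> (i, j) \<in> W \<Longrightarrow> (i2, j2) \<in> W \<Longrightarrow>
      i1 < i \<Longrightarrow> i < i2 \<Longrightarrow> j2 < j \<Longrightarrow> j < j1 \<Longrightarrow>
      (\<alpha> powi i - \<alpha> powi i1) * (\<alpha> powi j - \<alpha> powi j2) <
      (\<alpha> powi j1 - \<alpha> powi j) * (\<alpha> powi i2 - \<alpha> powi i)"
  shows "card W \<le> K + 2"
proof (rule ccontr)
  assume "\<not> card W \<le> K + 2"
  moreover have "inj_on fst W"
    using anti by (force simp: inj_on_def anti_pair_def)
  ultimately have "card (fst ` W) \<ge> Suc K + 2"
    by (simp add: card_image)
  then obtain i1 i i2 where "i1 \<in> fst ` W" "i \<in> fst ` W" "i2 \<in> fst ` W" "i1 < i"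
    and gap: "i + int (Suc K) \<le> i2"
    using int_set_gap[of "fst ` W" "Suc K"] fin by fastforce
  then obtain j1 j j2 where W: "(i1, j1) \<in> W" "(i, j) \<in> W" "(i2, j2) \<in> W"
    by auto
  have "i < i2" using gap by simp
  have j: "j2 < j" "j < j1"
    using anti[OF W(1,2)] anti[OF W(2,3)] \<open>i1 < i\<close> \<open>i < i2\<close> by (auto simp: anti_pair_def)
  have "i2 \<le> i + int K"
    using W sub \<open>i1 < i\<close> \<open>i < i2\<close> j
    by (intro good_lower_turn[OF good, of i1 j1 i j i2 j2] turn) auto
  then show False using gap by simp
qed

text \<open>Eliminates the coefficients of a separating functional: multiplying its inequalities at
  a left and a right point leaves the common factor \<open>a * b\<close>, which cancels.\<close>

lemma mult_slope_less:
  fixes a b :: real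
  assumes "a > 0" "b > 0" "b * p < a * q" "a * r < b * s" "p \<ge> 0" "r \<ge> 0"
  shows "p * r < q * s"
proof -
  have "(b * p) * (a * r) < (a * q) * (b * s)"
    using assms by (rule_tac mult_strict_mono') simp_all
  then have "(a * b) * (p * r) < (a * b) * (q * s)"
    by (simp only: mult_ac)
  then show ?thesis using assms(1,2) by (simp only: mult_less_cancel_left_pos mult_pos_pos)
qed

text \<open>The signs of the functional separating a vertex decide its chain: two positive
  coefficients give \<open>upper\<close>, two negative ones give \<open>lower\<close>. With mixed
  signs the vertex is an end of the staircase and still belongs to one of the chains.\<close>

lemma staircase_card:
  assumes good: "good \<alpha> V" and fin: "finite V"
    and no_iso: "\<And>p q. p \<in> V \<Longrightarrow> q \<in> V \<Longrightarrow> \<not> iso_pair p q"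
  shows "card V \<le> 2 * K + 3"
proof -
  define vertical :: "int \<Rightarrow> int \<Rightarrow> int \<Rightarrow> int \<Rightarrow> int \<Rightarrow> int \<Rightarrow> real"
    where "vertical = (\<lambda>i j i1 j1 i2 j2.
    (\<alpha> powi j1 - \<alpha> powi j) * (\<alpha> powi i2 - \<alpha> powi i))"
  define horizontal :: "int \<Rightarrow> int \<Rightarrow> int \<Rightarrow> int \<Rightarrow> int \<Rightarrow> int \<Rightarrow> real"
    where "horizontal = (\<lambda>i j i1 j1 i2 j2.
    (\<alpha> powi i - \<alpha> powi i1) * (\<alpha> powi j - \<alpha> powi j2))"
  \<comment> \<open>Maximal in the product order and strictly above every chord from a vertex to the
    upper left to one to the lower right; \<open>lower\<close> is the mirror image.\<close>
  define upper where "upper = (\<lambda>i j. (\<forall>k l. (k, l) \<in> V \<longrightarrow> i \<le> k \<longrightarrow> j \<le> l \<longrightarrow> (k, l) = (i, j)) \<and>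
    (\<forall>i1 j1 i2 j2. (i1, j1) \<in> V \<longrightarrow> (i2, j2) \<in> V \<longrightarrow> i1 < i \<longrightarrow> i < i2 \<longrightarrow> j2 < j \<longrightarrow> j < j1 \<longrightarrow>
      vertical i j i1 j1 i2 j2 < horizontal i j i1 j1 i2 j2))"
  define lower where "lower = (\<lambda>i j. (\<forall>k l. (k, l) \<in> V \<longrightarrow> k \<le> i \<longrightarrow> l \<le> j \<longrightarrow> (k, l) = (i, j)) \<and>
    (\<forall>i1 j1 i2 j2. (i1, j1) \<in> V \<longrightarrow> (i2, j2) \<in> V \<longrightarrow> i1 < i \<longrightarrow> i < i2 \<longrightarrow> j2 < j \<longrightarrow> j < j1 \<longrightarrow>
      horizontal i j i1 j1 i2 j2 < vertical i j i1 j1 i2 j2))"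
  have comparable: "(k \<le> i \<and> j \<le> l) \<or> (i \<le> k \<and> l \<le> j)" if "(i, j) \<in> V" "(k, l) \<in> V" for i j k l
    using no_iso[OF that] by (auto simp: iso_pair_def)
  have cover: "upper i j \<or> lower i j" if v: "(i, j) \<in> V" for i j
  proof -
    obtain a b c where f: "a * \<alpha> powi i + b * \<alpha> powi j + c > 0"
      "\<And>k l. (k, l) \<in> V \<Longrightarrow> (k, l) \<noteq> (i, j) \<Longrightarrow> a * \<alpha> powi k + b * \<alpha> powi l + c \<le> 0"
      using goodE[OF good] by blast
    consider "a > 0" "b > 0" | "a < 0" "b < 0" | "a \<le> 0" "b \<ge> 0" | "a \<ge> 0" "b \<le> 0"
      by linarith
    then show ?thesis
    proof cases
      case 1
      have "upper i j" unfolding upper_def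
      proof (intro conjI allI impI)
        fix k l assume "(k, l) \<in> V" "i \<le> k" "j \<le> l"
        then have "a * \<alpha> powi i \<le> a * \<alpha> powi k" "b * \<alpha> powi j \<le> b * \<alpha> powi l"
          using 1 by (simp_all add: powi_mono)
        then show "(k, l) = (i, j)" using f(1) f(2)[OF \<open>(k, l) \<in> V\<close>] by (cases "(k, l) = (i, j)") auto
      next
        fix i1 j1 i2 j2 assume *: "(i1, j1) \<in> V" "(i2, j2) \<in> V" "i1 < i" "i < i2" "j2 < j" "j < j1"
        have "b * (\<alpha> powi j1 - \<alpha> powi j) < a * (\<alpha> powi i - \<alpha> powi i1)"
          using f(1) f(2)[OF *(1)] *(3) by (simp add: algebra_simps)
        moreover have "a * (\<alpha> powi i2 - \<alpha> powi i) < b * (\<alpha> powi j - \<alpha> powi j2)"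
          using f(1) f(2)[OF *(2)] *(4) by (simp add: algebra_simps)
        moreover have "\<alpha> powi i < \<alpha> powi i2" "\<alpha> powi j < \<alpha> powi j1" "\<alpha> powi i1 < \<alpha> powi i"
          using * by (simp_all add: powi_less)
        ultimately show "vertical i j i1 j1 i2 j2 < horizontal i j i1 j1 i2 j2"
          unfolding vertical_def horizontal_def using 1 by (rule_tac mult_slope_less[of a b]) simp_all
      qed
      then show ?thesis ..
    next
      case 2
      have "lower i j" unfolding lower_def
      proof (intro conjI allI impI)
        fix k l assume "(k, l) \<in> V" "k \<le> i" "l \<le> j"
        then have "a * \<alpha> powi i \<le> a * \<alpha> powi k" "b * \<alpha> powi j \<le> b * \<alpha> powi l"
          using 2 by (simp_all add: powi_mono)
        then show "(k, l) = (i, j)" using f(1) f(2)[OF \<open>(k, l) \<in> V\<close>] by (cases "(k, l) = (i, j)") auto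
      next
        fix i1 j1 i2 j2 assume *: "(i1, j1) \<in> V" "(i2, j2) \<in> V" "i1 < i" "i < i2" "j2 < j" "j < j1"
        have "(-a) * (\<alpha> powi i - \<alpha> powi i1) < (-b) * (\<alpha> powi j1 - \<alpha> powi j)"
          using f(1) f(2)[OF *(1)] *(3) by (simp add: algebra_simps)
        moreover have "(-b) * (\<alpha> powi j - \<alpha> powi j2) < (-a) * (\<alpha> powi i2 - \<alpha> powi i)"
          using f(1) f(2)[OF *(2)] *(4) by (simp add: algebra_simps)
        moreover have "\<alpha> powi i1 < \<alpha> powi i" "\<alpha> powi j2 < \<alpha> powi j" "\<alpha> powi j < \<alpha> powi j1"
          using * by (simp_all add: powi_less)
        ultimately show "horizontal i j i1 j1 i2 j2 < vertical i j i1 j1 i2 j2"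
          unfolding vertical_def horizontal_def using 2 by (rule_tac mult_slope_less[of "-b" "-a"]) simp_all
      qed
      then show ?thesis ..
    next
      case 3
      have first: "(k, l) = (i, j)" if "(k, l) \<in> V" "k \<le> i" "j \<le> l" for k l
      proof -
        have "a * \<alpha> powi i \<le> a * \<alpha> powi k"
          using 3 that by (intro mult_left_mono_neg powi_mono; simp)
        moreover have "b * \<alpha> powi j \<le> b * \<alpha> powi l"
          using 3 that by (intro mult_left_mono powi_mono; simp)
        ultimately show ?thesis using f(1) f(2)[OF that(1)] by (cases "(k, l) = (i, j)") auto
      qed
      have vacuous: "\<not> (i1 < i \<and> i < i2 \<and> j2 < j \<and> j < j1)"
        if "(i1, j1) \<in> V" "(i2, j2) \<in> V" for i1 j1 i2 j2
        using first[of i1 j1] that by auto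
      have upperI: "upper i j" if "\<forall>k l. (k, l) \<in> V \<longrightarrow> i \<le> k \<longrightarrow> j \<le> l \<longrightarrow> (k, l) = (i, j)"
        unfolding upper_def using that vacuous by blast
      have lowerI: "lower i j" if "\<forall>k l. (k, l) \<in> V \<longrightarrow> k \<le> i \<longrightarrow> l \<le> j \<longrightarrow> (k, l) = (i, j)"
        unfolding lower_def using that vacuous by blast
      \<comment> \<open>Failing both needs another vertex weakly to the upper right and another
        weakly to the lower left. They form no increasing pair, so one of them shares a row or
        column with \<open>(i, j)\<close> and lies weakly to the upper left, against
        \<open>first\<close>.\<close>
      show ?thesis
      proof (rule ccontr)
        assume "\<not> (upper i j \<or> lower i j)"
        then obtain k l k' l' where "(k, l) \<in> V" "(k', l') \<in> V" "(k, l) \<noteq> (i, j)" "(k', l') \<noteq> (i, j)"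
          "i \<le> k" "j \<le> l" "k' \<le> i" "l' \<le> j"
          using upperI lowerI by blast
        then show False
          using comparable[of k l k' l'] first[of k l] first[of k' l'] by auto
      qed
    next
      case 4
      have last: "(k, l) = (i, j)" if "(k, l) \<in> V" "i \<le> k" "l \<le> j" for k l
      proof -
        have "a * \<alpha> powi i \<le> a * \<alpha> powi k"
          using 4 that by (intro mult_left_mono powi_mono; simp)
        moreover have "b * \<alpha> powi j \<le> b * \<alpha> powi l"
          using 4 that by (intro mult_left_mono_neg powi_mono; simp)
        ultimately show ?thesis using f(1) f(2)[OF that(1)] by (cases "(k, l) = (i, j)") auto
      qed
      have vacuous: "\<not> (i1 < i \<and> i < i2 \<and> j2 < j \<and> j < j1)"
        if "(i1, j1) \<in> V" "(i2, j2) \<in> V" for i1 j1 i2 j2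
        using last[of i2 j2] that by auto
      have upperI: "upper i j" if "\<forall>k l. (k, l) \<in> V \<longrightarrow> i \<le> k \<longrightarrow> j \<le> l \<longrightarrow> (k, l) = (i, j)"
        unfolding upper_def using that vacuous by blast
      have lowerI: "lower i j" if "\<forall>k l. (k, l) \<in> V \<longrightarrow> k \<le> i \<longrightarrow> l \<le> j \<longrightarrow> (k, l) = (i, j)"
        unfolding lower_def using that vacuous by blast
      show ?thesis
      proof (rule ccontr)
        assume "\<not> (upper i j \<or> lower i j)"
        then obtain k l k' l' where "(k, l) \<in> V" "(k', l') \<in> V" "(k, l) \<noteq> (i, j)" "(k', l') \<noteq> (i, j)"
          "i \<le> k" "j \<le> l" "k' \<le> i" "l' \<le> j"
          using upperI lowerI by blast
        then show False
          using comparable[of k l k' l'] last[of k l] last[of k' l'] by auto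
      qed
    qed
  qed
  define U where "U = {(i, j) \<in> V. upper i j}"
  define L where "L = {(i, j) \<in> V. lower i j}"
  have "card U \<le> K + 1"
  proof (rule upper_chain_card)
    show "finite U" using fin unfolding U_def by (auto intro: rev_finite_subset[OF fin])
  next
    fix p q assume "p \<in> U" "q \<in> U" "p \<noteq> q"
    moreover obtain i j k l where [simp]: "p = (i, j)" "q = (k, l)"
      by (cases p; cases q) auto
    ultimately have "(i, j) \<in> V" "(k, l) \<in> V" "(i, j) \<noteq> (k, l)" "upper i j" "upper k l"
      unfolding U_def by auto
    then have "\<not> (i \<le> k \<and> j \<le> l)" "\<not> (k \<le> i \<and> l \<le> j)" "k \<le> i \<and> j \<le> l \<or> i \<le> k \<and> l \<le> j"
      using comparable unfolding upper_def by metis+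
    then show "anti_pair p q"
      unfolding anti_pair_def by auto
  next
    fix i1 j1 i j i2 j2 assume "(i1, j1) \<in> U" "(i, j) \<in> U" "(i2, j2) \<in> U" "i1 < i" "i < i2" "j2 < j" "j < j1"
    then have "vertical i j i1 j1 i2 j2 < horizontal i j i1 j1 i2 j2"
      unfolding U_def upper_def by simp
    then show "(\<alpha> powi j1 - \<alpha> powi j) * (\<alpha> powi i2 - \<alpha> powi i) <
      (\<alpha> powi i - \<alpha> powi i1) * (\<alpha> powi j - \<alpha> powi j2)"
      unfolding vertical_def horizontal_def .
  qed
  moreover have "card L \<le> K + 2"
  proof (rule lower_chain_card[OF good])
    show "L \<subseteq> V" unfolding L_def by auto
    then show "finite L" using fin by (rule finite_subset)
  next
    fix p q assume "p \<in> L" "q \<in> L" "p \<noteq> q"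
    moreover obtain i j k l where [simp]: "p = (i, j)" "q = (k, l)"
      by (cases p; cases q) auto
    ultimately have "(i, j) \<in> V" "(k, l) \<in> V" "(i, j) \<noteq> (k, l)" "lower i j" "lower k l"
      unfolding L_def by auto
    then have "\<not> (i \<le> k \<and> j \<le> l)" "\<not> (k \<le> i \<and> l \<le> j)" "k \<le> i \<and> j \<le> l \<or> i \<le> k \<and> l \<le> j"
      using comparable unfolding lower_def by metis+
    then show "anti_pair p q"
      unfolding anti_pair_def by auto
  next
    fix i1 j1 i j i2 j2 assume "(i1, j1) \<in> L" "(i, j) \<in> L" "(i2, j2) \<in> L" "i1 < i" "i < i2" "j2 < j" "j < j1"
    then have "horizontal i j i1 j1 i2 j2 < vertical i j i1 j1 i2 j2"
      unfolding L_def lower_def by simp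
    then show "(\<alpha> powi i - \<alpha> powi i1) * (\<alpha> powi j - \<alpha> powi j2) <
      (\<alpha> powi j1 - \<alpha> powi j) * (\<alpha> powi i2 - \<alpha> powi i)"
      unfolding vertical_def horizontal_def .
  qed
  \<comment> \<open>A vertex may be on both chains; the union bound gives
    \<open>(K + 1) + (K + 2)\<close>.\<close>
  moreover have "V = U \<union> L" using cover unfolding U_def L_def by auto
  ultimately show ?thesis using card_Un_le[of U L] by simp
qed

lemma anti_pair_card:
  assumes "good \<alpha> V" "finite V" "p \<in> V" "q \<in> V" "anti_pair p q"
  shows "card V \<le> 2 * K + 3"
proof (cases "\<exists>r\<in>V. \<exists>s\<in>V. iso_pair r s")
  case True
  then obtain r s where "r \<in> V" "s \<in> V" "iso_pair r s" by blast
  then have "card V \<le> 4" using card_anti_iso assms by blast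
  then show ?thesis using K_pos by linarith
next
  case False
  then show ?thesis using staircase_card assms by blast
qed

text \<open>If \<open>V\<close> is too large, neither \<open>V\<close> nor its two images under the
  symmetries contain a decreasing pair. Then any two vertices agree in \<open>x\<close>, in
  \<open>y\<close> or in \<open>y - x\<close>, and each of these lines through a fixed
  \<open>p\<close> holds at most one more vertex, so \<open>V\<close> has at most four.\<close>

lemma good_card:
  assumes good: "good \<alpha> V" and fin: "finite V"
  shows "card V \<le> 2 * K + 3"
proof (rule ccontr)
  assume large: "\<not> card V \<le> 2 * K + 3"
  have inj: "inj_on proj_swap W" "inj_on prod.swap W" for W
    by (rule inj_on_subset[OF inj_proj_swap subset_UNIV], rule inj_swap)
  have no_anti: "\<not> anti_pair p q" if "good \<alpha> W" "finite W" "card W = card V" "p \<in> W" "q \<in> W" for W p q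
    using anti_pair_card[OF that(1,2,4,5)] that(3) large by auto
  note good' = good_proj_swap[OF good] good_proj_swap[OF good_swap[OF good]]
  have axis: "fst q = fst p \<or> snd q = snd p \<or> snd q - fst q = snd p - fst p"
    if "p \<in> V" "q \<in> V" for p q
  proof -
    have "\<not> anti_pair p q" using no_anti[OF good fin] that by blast
    moreover have "\<not> anti_pair (proj_swap p) (proj_swap q)"
      using no_anti[OF good'(1)] fin that by (simp add: card_image inj)
    moreover have "\<not> anti_pair (proj_swap (prod.swap p)) (proj_swap (prod.swap q))"
      using no_anti[OF good'(2)] fin that by (simp add: card_image inj)
    ultimately show ?thesis
      unfolding anti_pair_def proj_swap_def fst_conv snd_conv fst_swap snd_swap by presburger
  qed
  have "V \<noteq> {}" using large by auto
  then obtain p where p: "p \<in> V" by blast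
  define R where "R = {q \<in> V. q \<noteq> p \<and> snd q = snd p}"
  define C where "C = {q \<in> V. q \<noteq> p \<and> fst q = fst p}"
  define D where "D = {q \<in> V. q \<noteq> p \<and> snd q - fst q = snd p - fst p}"
  have fin': "finite R" "finite C" "finite D" using fin by (auto simp: R_def C_def D_def)
  have "\<forall>x\<in>R. \<forall>y\<in>R. x = y" "\<forall>x\<in>C. \<forall>y\<in>C. x = y" "\<forall>x\<in>D. \<forall>y\<in>D. x = y"
    using good_row_unique[OF good p] good_col_unique[OF good p] good_diag_unique[OF good p]
    unfolding R_def C_def D_def by blast+
  then have "card R \<le> 1" "card C \<le> 1" "card D \<le> 1"
    using fin' by (simp_all add: card_le_Suc0_iff_eq)
  moreover have "V \<subseteq> {p} \<union> R \<union> C \<union> D"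
    using axis[OF p] unfolding R_def C_def D_def by blast
  then have "card V \<le> card ({p} \<union> R \<union> C \<union> D)"
    using fin' by (intro card_mono) auto
  moreover have "card ({p} \<union> R \<union> C \<union> D) \<le> 1 + card R + card C + card D"
    using card_Un_le[of "{p}" R] card_Un_le[of "{p} \<union> R" C] card_Un_le[of "{p} \<union> R \<union> C" D] by simp
  ultimately show False using large K_pos by simp
qed

end

section \<open>Translation of empty polygons into exponents\<close>

context exp_base
begin

definition lattice_point :: "int \<times> int \<Rightarrow> real \<times> real"
  where "lattice_point p = (\<alpha> powi fst p, \<alpha> powi snd p)"

lemma inj_lattice_point: "inj lattice_point"
proof (rule injI)
  fix p q assume "lattice_point p = lattice_point q"
  then have "\<not> fst p < fst q" "\<not> fst q < fst p" "\<not> snd p < snd q" "\<not> snd q < snd p"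
    using powi_less unfolding lattice_point_def by force+
  then show "p = q" by (simp add: prod_eq_iff)
qed

lemma exp_lattice_eq: "exp_lattice \<alpha> = lattice_point ` {(i, j). 0 \<le> i \<and> 0 \<le> j}"
proof -
  have "{\<alpha> ^ n | n. True} = (powi) \<alpha> ` {0..}"
  proof (intro equalityI subsetI)
    fix x assume "x \<in> {\<alpha> ^ n | n. True}"
    then obtain n where "x = \<alpha> ^ n" by blast
    then have "x = \<alpha> powi int n" by simp
    then show "x \<in> (powi) \<alpha> ` {0..}" by (rule image_eqI) simp
  next
    fix x assume "x \<in> (powi) \<alpha> ` {0..}"
    then obtain i where "i \<ge> 0" "x = \<alpha> powi i" by blast
    then have "x = \<alpha> ^ nat i" by (simp add: power_int_def)
    then show "x \<in> {\<alpha> ^ n | n. True}" by blast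
  qed
  then show ?thesis
    unfolding exp_lattice_def lattice_point_def by (auto simp: image_iff)
qed

text \<open>No point with integer exponents lies in the hull of the vertices other than itself; a
  separating hyperplane then supplies the functional.\<close>

lemma empty_polygon_good:
  assumes "empty_polygon_in (exp_lattice \<alpha>) P"
  shows "good \<alpha> (lattice_point -` vertices P)"
    and "finite (lattice_point -` vertices P)"
    and "card (lattice_point -` vertices P) = card (vertices P)"
proof -
  have poly: "polytope P" and vert: "vertices P \<subseteq> exp_lattice \<alpha>"
    and empty: "P \<inter> exp_lattice \<alpha> \<subseteq> vertices P"
    using assms unfolding empty_polygon_in_def convex_polygon_def by auto
  have fin: "finite (vertices P)"
    unfolding vertices_def by (intro finite_polyhedron_extreme_points polytope_imp_polyhedron poly)
  then show "finite (lattice_point -` vertices P)"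
    by (rule finite_vimageI[OF _ inj_lattice_point])
  show "card (lattice_point -` vertices P) = card (vertices P)"
    using vert unfolding exp_lattice_eq by (intro card_vimage_inj inj_lattice_point) auto
  have conv: "convex P" using poly by (rule polytope_imp_convex)
  have hull: "P = convex hull (vertices P)"
    unfolding vertices_def by (intro Krein_Milman_Minkowski polytope_imp_compact poly conv)
  have quadrant: "P \<subseteq> {1..} \<times> {1..}"
  proof -
    have "vertices P \<subseteq> {1..} \<times> {1..}"
      using vert base_gt_1 by (auto simp: exp_lattice_def)
    then have "convex hull (vertices P) \<subseteq> {1..} \<times> {1..}"
      by (intro hull_minimal convex_Times) auto
    then show ?thesis using hull by simp
  qed
  show "good \<alpha> (lattice_point -` vertices P)"
  proof (rule goodI)
    fix i j
    define s where "s = lattice_point (i, j)"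
    define H where "H = convex hull (vertices P - {s})"
    have "s \<notin> H"
    proof
      assume "s \<in> H"
      have "H \<subseteq> convex hull (vertices P)"
        unfolding H_def by (intro hull_mono) auto
      then have "s \<in> P" using \<open>s \<in> H\<close> hull by auto
      \<comment> \<open>\<open>good\<close> also ranges over negative exponents; such points are
        outside the quadrant that contains \<open>P\<close>.\<close>
      then have "1 \<le> \<alpha> powi i" "1 \<le> \<alpha> powi j"
        using quadrant unfolding s_def lattice_point_def by auto
      then have "\<not> i < 0" "\<not> j < 0" using powi_less[of i 0] powi_less[of j 0] by auto
      then have "s \<in> exp_lattice \<alpha>" unfolding exp_lattice_eq s_def by auto
      then have "s extreme_point_of P" using \<open>s \<in> P\<close> empty unfolding vertices_def by auto
      \<comment> \<open>Removing an extreme point keeps \<open>P\<close> convex, so the hull of the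
        other vertices misses \<open>s\<close>.\<close>
      then have "convex (P - {s})" using conv by (simp add: extreme_point_of_stillconvex)
      moreover have "vertices P - {s} \<subseteq> P - {s}"
        unfolding vertices_def extreme_point_of_def by auto
      ultimately have "H \<subseteq> P - {s}" unfolding H_def by (rule hull_minimal[rotated])
      then show False using \<open>s \<in> H\<close> by auto
    qed
    moreover have "convex H" "closed H"
      unfolding H_def using fin
      by (auto intro: compact_imp_closed finite_imp_compact_convex_hull)
    ultimately obtain n d where n: "n \<bullet> s < d" "\<And>x. x \<in> H \<Longrightarrow> d < n \<bullet> x"
      using separating_hyperplane_closed_point by metis
    show "\<exists>a b c. 0 < a * \<alpha> powi i + b * \<alpha> powi j + c \<and>
      (\<forall>k l. (k, l) \<in> lattice_point -` vertices P \<longrightarrow> (k, l) \<noteq> (i, j) \<longrightarrow>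
        a * \<alpha> powi k + b * \<alpha> powi l + c \<le> 0)"
    proof (rule exI[of _ "- fst n"], rule exI[of _ "- snd n"], rule exI[of _ d], intro conjI allI impI)
      show "0 < - fst n * \<alpha> powi i + - snd n * \<alpha> powi j + d"
        using n(1) unfolding s_def lattice_point_def by (simp add: inner_prod_def)
    next
      fix k l assume "(k, l) \<in> lattice_point -` vertices P" "(k, l) \<noteq> (i, j)"
      then have "lattice_point (k, l) \<in> vertices P - {s}"
        unfolding s_def using inj_lattice_point by (auto simp: inj_eq)
      then have "lattice_point (k, l) \<in> H" unfolding H_def by (rule hull_inc)
      then show "- fst n * \<alpha> powi k + - snd n * \<alpha> powi l + d \<le> 0"
        using n(2)[of "lattice_point (k, l)"] unfolding lattice_point_def by (simp add: inner_prod_def)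
    qed
  qed
qed

end

lemma (in exp_chain) h_le: "h (exp_lattice \<alpha>) \<le> enat (2 * K + 3)"
  unfolding h_def
proof (rule Sup_least)
  fix k assume "k \<in> {enat (card (vertices P)) | P. empty_polygon_in (exp_lattice \<alpha>) P}"
  then obtain P where k: "k = enat (card (vertices P))" and P: "empty_polygon_in (exp_lattice \<alpha>) P"
    by auto
  have "card (vertices P) \<le> 2 * K + 3"
    using good_card[OF empty_polygon_good(1,2)[OF P]] by (simp only: empty_polygon_good(3)[OF P])
  then show "k \<le> enat (2 * K + 3)"
    unfolding k by (simp only: enat_ord_simps)
qed

section \<open>Certificates for empty polygons\<close>

lemma aff_dim_convex_independent:
  fixes W :: "(real \<times> real) set"
  assumes "card W \<ge> 3" and indep: "\<And>w. w \<in> W \<Longrightarrow> w \<notin> convex hull (W - {w})"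
  shows "aff_dim W = 2"
proof -
  have "\<not> collinear W"
  proof
    assume "collinear W"
    obtain T where "T \<subseteq> W" "card T = 3"
      by (rule obtain_subset_with_card_n[OF assms(1)])
    then obtain u v w where T: "{u, v, w} \<subseteq> W" "u \<noteq> v" "v \<noteq> w" "u \<noteq> w"
      unfolding card_3_iff by auto
    have "collinear {u, v, w}" using \<open>collinear W\<close> T(1) by (rule collinear_subset)
    \<comment> \<open>Of three collinear points one is between the others, hence in their
      hull.\<close>
    moreover have "\<not> between (y, z) x" if "x \<in> W" "{y, z} \<subseteq> W - {x}" for x y z
      using indep[OF that(1)] hull_mono[OF that(2), of convex] by (auto simp: between_mem_convex_hull)
    ultimately show False using T by (auto simp: collinear_between_cases)
  qed
  then have "aff_dim W > 1" by (simp add: collinear_aff_dim)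
  moreover have "aff_dim W \<le> 2" using aff_dim_le_DIM[of W] by simp
  ultimately show ?thesis by simp
qed

text \<open>The condition of \<open>good\<close> at a single point, in real coordinates instead of
  exponents.\<close>

definition separated :: "(real \<times> real) set \<Rightarrow> real \<Rightarrow> real \<Rightarrow> bool"
  where "separated W x y \<longleftrightarrow> (\<exists>p q c. p * x + q * y + c > 0 \<and>
    (\<forall>(u, v) \<in> W - {(x, y)}. p * u + q * v + c \<le> 0))"

lemma separatedI:
  assumes "p * x + q * y + c > 0"
    "\<And>u v. (u, v) \<in> W \<Longrightarrow> u = x \<and> v = y \<or> p * u + q * v + c \<le> 0"
  shows "separated W x y"
  unfolding separated_def
  by (rule exI[of _ p], rule exI[of _ q], rule exI[of _ c]) (use assms in blast)

lemma separated_swap: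
  assumes "separated W x y" and sym: "prod.swap ` W = W"
  shows "separated W y x"
proof -
  obtain p q c where *: "p * x + q * y + c > 0" "\<forall>(u, v) \<in> W - {(x, y)}. p * u + q * v + c \<le> 0"
    using assms(1) unfolding separated_def by blast
  show ?thesis
  proof (rule separatedI)
    show "q * y + p * x + c > 0" using *(1) by simp
  next
    fix u v assume "(u, v) \<in> W"
    then have "(v, u) \<in> W" using sym by force
    then show "u = y \<and> v = x \<or> q * u + p * v + c \<le> 0"
      using *(2) by (auto simp: add.commute)
  qed
qed

text \<open>Separation at points of \<open>W\<close> makes them exactly the vertices of the hull; at
  all other lattice points it gives emptiness. By the symmetry of \<open>W\<close>, points on or
  below the diagonal suffice.\<close>

lemma h_ge:
  assumes "finite W" "W \<subseteq> exp_lattice \<alpha>" "card W \<ge> 3" and sym: "prod.swap ` W = W"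
    and sep_le: "\<And>i j :: nat. j \<le> i \<Longrightarrow> separated W (\<alpha> ^ i) (\<alpha> ^ j)"
  shows "h (exp_lattice \<alpha>) \<ge> enat (card W)"
proof -
  have sep: "separated W (\<alpha> ^ i) (\<alpha> ^ j)" for i j :: nat
    using sep_le[of j i] separated_swap[OF sep_le[of i j] sym] by linarith
  have hull: "s \<notin> convex hull (W - {s})" if s_in: "s \<in> exp_lattice \<alpha>" for s
  proof
    assume "s \<in> convex hull (W - {s})"
    obtain i j :: nat where s: "s = (\<alpha> ^ i, \<alpha> ^ j)"
      using s_in unfolding exp_lattice_def by blast
    obtain a b c where pos: "a * \<alpha> ^ i + b * \<alpha> ^ j + c > 0"
      and neg: "\<And>x y. (x, y) \<in> W - {s} \<Longrightarrow> a * x + b * y + c \<le> 0"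
      using sep[of i j] unfolding s separated_def by blast
    have "W - {s} \<subseteq> {z. (a, b) \<bullet> z \<le> - c}"
    proof
      fix z assume "z \<in> W - {s}"
      then show "z \<in> {z. (a, b) \<bullet> z \<le> - c}" using neg[of "fst z" "snd z"] by (simp add: inner_prod_def)
    qed
    then have "convex hull (W - {s}) \<subseteq> {z. (a, b) \<bullet> z \<le> - c}"
      by (intro hull_minimal convex_halfspace_le)
    then show False using \<open>s \<in> convex hull (W - {s})\<close> pos unfolding s by (auto simp: inner_prod_def)
  qed
  have vert: "vertices (convex hull W) = W"
    unfolding vertices_def
    using extreme_point_of_convex_hull_convex_independent[OF finite_imp_compact[OF assms(1)]] hull assms(2)
    by blast
  have "aff_dim (convex hull W) = 2"
    using aff_dim_convex_independent[OF assms(3)] hull assms(2) by (auto simp: aff_dim_convex_hull)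
  then have "convex_polygon (convex hull W)"
    unfolding convex_polygon_def polytope_def using assms(1) by auto
  moreover have "convex hull W \<inter> exp_lattice \<alpha> \<subseteq> W"
  proof
    fix s assume s: "s \<in> convex hull W \<inter> exp_lattice \<alpha>"
    show "s \<in> W"
    proof (rule ccontr)
      assume "s \<notin> W"
      then show False using hull[of s] s by simp
    qed
  qed
  ultimately have "empty_polygon_in (exp_lattice \<alpha>) (convex hull W)"
    unfolding empty_polygon_in_def vert using assms(2) by blast
  then have "enat (card W) \<in> {enat (card (vertices P)) | P. empty_polygon_in (exp_lattice \<alpha>) P}"
    by (intro CollectI exI[of _ "convex hull W"]) (simp add: vert)
  then show ?thesis
    unfolding h_def by (rule Sup_upper)
qed

section \<open>Explicit pentagon and heptagon\<close>

lemma pentagon: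
  fixes a :: real
  assumes a: "a > 1"
  shows "h (exp_lattice a) \<ge> 5"
proof -
  \<comment> \<open>Three vertices lie on the hyperbola \<open>x * y = a\<^sup>2\<close> and two on
    \<open>x * y = a ^ 3\<close>.\<close>
  define W where "W = {(1, a\<^sup>2), (a, a\<^sup>2), (a, a), (a\<^sup>2, a), (a\<^sup>2, 1)}"
  have a2: "a < a\<^sup>2" using a by (simp add: power2_eq_square)
  have card: "card W = 5" using a a2 unfolding W_def by simp
  have sub: "W \<subseteq> exp_lattice a"
  proof -
    have "a ^ k \<in> {a ^ n | n. True}" for k by blast
    from this[of 0] this[of 1] this[of 2] show ?thesis
      unfolding W_def exp_lattice_def by simp
  qed
  have sepI: "separated W x y"
    if "p * x + q * y + c > 0"
      "x = 1 \<and> y = a\<^sup>2 \<or> p + q * a\<^sup>2 + c \<le> 0" "x = a \<and> y = a\<^sup>2 \<or> p * a + q * a\<^sup>2 + c \<le> 0"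
      "x = a \<and> y = a \<or> p * a + q * a + c \<le> 0"
      "x = a\<^sup>2 \<and> y = a \<or> p * a\<^sup>2 + q * a + c \<le> 0" "x = a\<^sup>2 \<and> y = 1 \<or> p * a\<^sup>2 + q + c \<le> 0"
    for x y p q c
    by (rule separatedI[OF that(1)]) (use that in \<open>auto simp: W_def\<close>)
  have sep_le: "separated W (a ^ i) (a ^ j)" if "j \<le> i" for i j :: nat
  proof -
    have aa: "a * a > a" using a by simp
    \<comment> \<open>Cases 3 to 5 are vertices. The zero line of the functional passes through both
      neighbours of the vertex in cases 3 and 5, and contains an edge in cases 1, 2 and 6. In case 4
      the vertex is the only one below height \<open>a\<close>.\<close>
    have "i > 2 \<or> i = 2 \<and> j = 2 \<or> i = 2 \<and> j = 1 \<or> i = 2 \<and> j = 0 \<or> i = 1 \<and> j = 1 \<or> i \<le> 1 \<and> j = 0"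
      using that by presburger
    then consider "i > 2" | "i = 2" "j = 2" | "i = 2" "j = 1" | "i = 2" "j = 0" | "i = 1" "j = 1" | "i \<le> 1" "j = 0"
      by blast
    then show ?thesis
    proof cases
      case 1
      then have "a\<^sup>2 < a ^ i" using a by (intro power_strict_increasing) auto
      then show ?thesis
        using a a2 by (intro sepI[where p = 1 and q = 0 and c = "- a\<^sup>2"]) simp_all
    next
      case 2
      show ?thesis unfolding 2
        using a a2 by (intro sepI[where p = 1 and q = 1 and c = "- a\<^sup>2 - a"]) simp_all
    next
      case 3
      have "(a\<^sup>2 - 1) * (1 - a\<^sup>2) + (a\<^sup>2 - a) * (a\<^sup>2 - 1) = - ((a\<^sup>2 - 1) * (a - 1))"
        "(a\<^sup>2 - 1) * (a - a\<^sup>2) + (a\<^sup>2 - a) * (a - 1) = - (a * (a - 1) * (a\<^sup>2 - a))"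
        by (simp_all add: algebra_simps power2_eq_square)
      moreover have "(a\<^sup>2 - 1) * (a - 1) > 0" "a * (a - 1) * (a\<^sup>2 - a) > 0" "(a\<^sup>2 - a) * (a - 1) > 0"
        using a a2 by simp_all
      ultimately show ?thesis unfolding 3
        by (intro sepI[where p = "a\<^sup>2 - 1" and q = "a\<^sup>2 - a" and c = "- (a\<^sup>2 - 1) * a\<^sup>2 - (a\<^sup>2 - a)"])
          (simp_all add: algebra_simps power2_eq_square)
    next
      case 4
      show ?thesis unfolding 4
        using a a2 by (intro sepI[where p = 0 and q = "-1" and c = a]) simp_all
    next
      case 5
      have "(a - 1) * (a - 1) > 0" using a by simp
      then show ?thesis unfolding 5
        using a a2 by (intro sepI[where p = "-1" and q = "-1" and c = "a\<^sup>2 + 1"])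
          (simp_all add: algebra_simps power2_eq_square)
    next
      case 6
      have "a ^ i \<le> a" using 6 a power_increasing[of i 1 a] by simp
      then have "a ^ i < a * a" using aa by linarith
      moreover have "(a\<^sup>2 - 1) * (a - 1) > 0" using a a2 by simp
      ultimately show ?thesis unfolding 6(2)
        using a a2 by (intro sepI[where p = "-1" and q = "-a" and c = "a\<^sup>2 + a"])
          (simp_all add: algebra_simps power2_eq_square)
    qed
  qed
  have "h (exp_lattice a) \<ge> enat (card W)"
    by (rule h_ge[OF _ sub _ _ sep_le]) (use card in \<open>auto simp: W_def\<close>)
  then show ?thesis unfolding card by (simp add: numeral_eq_enat)
qed

lemma heptagon:
  fixes a :: real
  assumes a: "a < 2" and golden: "a + 1 \<le> a\<^sup>2" and a1: "a > 1"
  shows "h (exp_lattice a) \<ge> 7"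
proof -
  \<comment> \<open>The condition \<open>M * (2 - a) > 1\<close> says exactly that
    \<open>(a * M, a * M)\<close> lies beyond the chord from \<open>(a, a * (a * M))\<close> to its
    mirror image; \<open>M > a\<close> keeps the vertices distinct.\<close>
  obtain m where m: "a ^ m > max a (1 / (2 - a))"
    using real_arch_pow[OF a1] by blast
  define M where "M = a ^ m"
  have M: "M > a" "M * (2 - a) > 1"
    using m a unfolding M_def by (simp_all add: field_simps)
  \<comment> \<open>The height of \<open>(a * M, a * M)\<close> and of \<open>(M, a * M)\<close>
    above \<open>(a * (a * M), 1)\<close>, used for the lines joining these points.\<close>
  define N where "N = a * M - 1"
  have aM: "a * M > M" "a * (a * M) > a * M" "a * M > a"
    using a1 M by simp_all
  have N: "N > 0" using aM(1) M(1) a1 unfolding N_def by linarith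
  \<comment> \<open>As \<open>M \<rightarrow> \<infinity>\<close>, the rescaled upper right chain tends to \<open>(0, 1), (1/a, 1/a), (1, 0)\<close>, which is strictly
    convex exactly when \<open>a < 2\<close>; for the two inner lower left vertices the golden ratio bound is needed.\<close>
  define W where "W = {(1, a * (a * M)), (a, a * (a * M)), (M, a * M), (a * M, a * M),
    (a * M, M), (a * (a * M), a), (a * (a * M), 1)}"
  have "card {(1, d), (a, d), (b, c), (c, c), (c, b), (d, a), (d, 1)} = 7"
    if "a < b" "b < c" "c < d" for b c d :: real
    using that a1 by simp
  then have card: "card W = 7"
    using M aM unfolding W_def by blast
  have sub: "W \<subseteq> exp_lattice a"
  proof -
    have "a ^ k \<in> {a ^ n | n. True}" for k by blast
    from this[of 0] this[of 1] this[of m] this[of "Suc m"] this[of "Suc (Suc m)"] show ?thesis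
      unfolding W_def M_def exp_lattice_def by simp
  qed
  have sepI: "separated W x y"
    if "p * x + q * y + c > 0"
      "x = 1 \<and> y = a * (a * M) \<or> p + q * (a * (a * M)) + c \<le> 0"
      "x = a \<and> y = a * (a * M) \<or> p * a + q * (a * (a * M)) + c \<le> 0"
      "x = M \<and> y = a * M \<or> p * M + q * (a * M) + c \<le> 0"
      "x = a * M \<and> y = a * M \<or> p * (a * M) + q * (a * M) + c \<le> 0"
      "x = a * M \<and> y = M \<or> p * (a * M) + q * M + c \<le> 0"
      "x = a * (a * M) \<and> y = a \<or> p * (a * (a * M)) + q * a + c \<le> 0"
      "x = a * (a * M) \<and> y = 1 \<or> p * (a * (a * M)) + q + c \<le> 0"
    for x y p q c
    by (rule separatedI[OF that(1)]) (use that in \<open>auto simp: W_def\<close>)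
  have "a * (a * M) - 1 > 0" using aM(1,2) M(1) a1 by linarith
  then have pos: "M > 0" "a > 0" "a - 1 > 0" "M - 1 > 0" "a * (a * M) - 1 > 0" "a\<^sup>2 - a - 1 \<ge> 0" "M * (2 - a) - 1 > 0"
    using a1 M golden by simp_all
  have one_le: "1 \<le> a * a" "1 \<le> a * M" "1 \<le> a * (a * M)"
    using aM M a1 pos(5) less_1_mult[OF a1 a1] by linarith+
  have golden_M: "M * (a\<^sup>2 - a - 1) \<ge> 0" using pos by simp
  have golden_pos: "M * (a\<^sup>2 - a - 1) + 1 > 0" using golden_M by linarith
  have sep_le: "separated W (a ^ i) (a ^ j)" if "j \<le> i" for i j :: nat
  proof -
    \<comment> \<open>Cases 3 to 6 are vertices. The zero line passes through both neighbours of the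
      vertex in cases 3, 5 and 6, and contains an edge in cases 1, 2, 7 and 8. In case 4 the vertex
      is the only one below height \<open>a\<close>.\<close>
    have "i > m + 2 \<or> i = m + 2 \<and> j \<ge> 2 \<or> i = m + 2 \<and> j = 1 \<or> i = m + 2 \<and> j = 0 \<or>
      i = m + 1 \<and> j = m + 1 \<or> i = m + 1 \<and> j = m \<or> i = m + 1 \<and> j < m \<or> i \<le> m \<and> j \<le> m"
      using that by presburger
    then consider "i > m + 2" | "i = m + 2" "j \<ge> 2" | "i = m + 2" "j = 1" | "i = m + 2" "j = 0"
      | "i = m + 1" "j = m + 1" | "i = m + 1" "j = m" | "i = m + 1" "j < m" | "i \<le> m" "j \<le> m"
      by blast
    then show ?thesis
    proof cases
      case 1
      then have "a ^ (m + 2) < a ^ i" using a1 by (intro power_strict_increasing) auto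
      then have "a * (a * M) < a ^ i" by (simp add: M_def)
      then show ?thesis
        using a1 M aM by (intro sepI[where p = 1 and q = 0 and c = "- (a * (a * M))"])
            (simp_all add: one_le)
    next
      case 2
      have x: "a ^ i = a * (a * M)" using 2 by (simp add: M_def)
      have "a < a\<^sup>2" using a1 by (simp add: power2_eq_square)
      also have "\<dots> \<le> a ^ j" using 2 a1 by (intro power_increasing) auto
      finally have y: "a < a ^ j" .
      \<comment> \<open>The edge from \<open>(a * M, a * M)\<close> to
        \<open>(a * (a * M), a)\<close>; its normal vector is divided by \<open>a\<close>.\<close>
      define p q c where pqc: "p = M - 1" "q = M * (a - 1)" "c = - (p * (a * (a * M)) + q * a)"
      have p: "p > 0" and q: "q > 0" using pos unfolding pqc by simp_all
      have v2: "p * a + q * (a * (a * M)) + c = - (a * N * (M * (2 - a) - 1))"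
        and v5: "p * (a * M) + q * (a * M) + c = 0"
        unfolding pqc N_def by (simp_all add: algebra_simps)
      have "a * N * (M * (2 - a) - 1) > 0" using pos N by simp
      then have v2': "p * a + q * (a * (a * M)) + c \<le> 0" using v2 by linarith
      show ?thesis unfolding x
      proof (rule sepI[where p = p and q = q and c = c])
        show "p * (a * (a * M)) + q * a ^ j + c > 0"
          using mult_strict_left_mono[OF y q] unfolding pqc(3) by simp
        have "p \<le> p * a" using p a1 by simp
        then show "a * (a * M) = 1 \<and> a ^ j = a * (a * M) \<or> p + q * (a * (a * M)) + c \<le> 0"
          using v2' by linarith
        have "p * M \<le> p * (a * M)" "q * M \<le> q * (a * M)" using p q aM by simp_all
        then show "a * (a * M) = M \<and> a ^ j = a * M \<or> p * M + q * (a * M) + c \<le> 0"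
          "a * (a * M) = a * M \<and> a ^ j = M \<or> p * (a * M) + q * M + c \<le> 0"
          using v5 by linarith+
        have "q \<le> q * a" using q a1 by simp
        then show "a * (a * M) = a * (a * M) \<and> a ^ j = 1 \<or> p * (a * (a * M)) + q + c \<le> 0"
          unfolding pqc(3) by linarith
      qed (use v2' v5 in \<open>simp_all add: pqc(3)\<close>)
    next
      case 3
      have x: "a ^ i = a * (a * M)" "a ^ j = a" using 3 by (simp_all add: M_def)
      define p q c where pqc: "p = N" "q = a * M * (a - 1)" "c = - (p * (a * (a * M)) + q)"
      have p: "p > 0" and q: "q > 0" using pos N unfolding pqc by simp_all
      have v1: "p + q * (a * (a * M)) + c = - ((a * (a * M) - 1) * (a * M * (2 - a) - 1))"
        and v2: "p * a + q * (a * (a * M)) + c =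
          - (a * (M * M * (a * a) * (2 - a) - M * (a + 1) + 1))"
        and v5: "p * (a * M) + q * (a * M) + c = 0"
        unfolding pqc N_def by (simp_all add: algebra_simps)
      have "M * (a + 1) \<le> M * a\<^sup>2" using golden pos by simp
      also have "\<dots> \<le> M * a\<^sup>2 * (M * (2 - a))"
        using pos mult_left_mono[of 1 "M * (2 - a)" "M * a\<^sup>2"] by simp
      finally have "M * M * (a * a) * (2 - a) - M * (a + 1) + 1 > 0"
        by (simp add: algebra_simps power2_eq_square)
      then have "a * (M * M * (a * a) * (2 - a) - M * (a + 1) + 1) > 0" using pos by simp
      then have v2': "p * a + q * (a * (a * M)) + c \<le> 0" using v2 by linarith
      have "p \<le> p * a" using p a1 by simp
      then have v1': "p + q * (a * (a * M)) + c \<le> 0" using v2' by linarith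
      show ?thesis unfolding x
      proof (rule sepI[where p = p and q = q and c = c])
        show "p * (a * (a * M)) + q * a + c > 0"
          using q a1 unfolding pqc(3) by simp
        have "p * M \<le> p * (a * M)" "q * M \<le> q * (a * M)" using p q aM by simp_all
        then show "a * (a * M) = M \<and> a = a * M \<or> p * M + q * (a * M) + c \<le> 0"
          "a * (a * M) = a * M \<and> a = M \<or> p * (a * M) + q * M + c \<le> 0"
          using v5 by linarith+
      qed (use v1' v2' v5 in \<open>simp_all add: pqc(3)\<close>)
    next
      case 4
      have x: "a ^ i = a * (a * M)" "a ^ j = 1" using 4 by (simp_all add: M_def)
      show ?thesis unfolding x
        using a1 M aM by (intro sepI[where p = 0 and q = "-1" and c = a]) (simp_all add: one_le)
    next
      case 5
      have x: "a ^ i = a * M" "a ^ j = a * M" using 5 by (simp_all add: M_def)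
      have "a * (M * (2 - a) - 1) > 0" using pos by simp
      moreover have "a * M + M \<le> a * (a * M)"
        using golden_M by (simp add: algebra_simps power2_eq_square)
      ultimately show ?thesis unfolding x
        using a1 M aM
        by (intro sepI[where p = 1 and q = 1 and c = "- (a * (a * M) + a)"])
          (simp_all add: algebra_simps one_le)
    next
      case 6
      have x: "a ^ i = a * M" "a ^ j = M" using 6 by (simp_all add: M_def)
      \<comment> \<open>The line joins \<open>(M, a * M)\<close> and
        \<open>(a * (a * M), 1)\<close>; the golden ratio bound puts the vertex strictly below
        it.\<close>
      define p q c where pqc: "p = - N" "q = - (M * (a * a - 1))" "c = - q - p * (a * (a * M))"
      have aa: "a * a > 1" using a1 less_1_mult by blast
      have p: "p < 0" and q: "q < 0" using pos N aa unfolding pqc by simp_all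
      have v1: "p + q * (a * (a * M)) + c = - ((a * (a * M) - 1) * (M * (a\<^sup>2 - a - 1) + 1))"
        and v3: "p * M + q * (a * M) + c = 0"
        and v4: "p * (a * M) + q * M + c = M * (a - 1) * (M * (a\<^sup>2 - a - 1) + 1)"
        unfolding pqc N_def by (simp_all add: algebra_simps power2_eq_square)
      have "(a * (a * M) - 1) * (M * (a\<^sup>2 - a - 1) + 1) > 0"
        using pos by (intro mult_pos_pos golden_pos) auto
      then have v1': "p + q * (a * (a * M)) + c \<le> 0" using v1 by linarith
      show ?thesis unfolding x
      proof (rule sepI[where p = p and q = q and c = c])
        have "M * (a - 1) * (M * (a\<^sup>2 - a - 1) + 1) > 0"
          using pos by (intro mult_pos_pos golden_pos) auto
        then show "p * (a * M) + q * M + c > 0" using v4 by simp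
        have "p * a \<le> p" using p a1 by simp
        then show "a * M = a \<and> M = a * (a * M) \<or> p * a + q * (a * (a * M)) + c \<le> 0"
          using v1' by linarith
        have "p * (a * M) \<le> p * M" using p aM by simp
        then show "a * M = a * M \<and> M = a * M \<or> p * (a * M) + q * (a * M) + c \<le> 0"
          using v3 by linarith
        have "q * a \<le> q" using q a1 by simp
        then show "a * M = a * (a * M) \<and> M = a \<or> p * (a * (a * M)) + q * a + c \<le> 0"
          unfolding pqc(3) by linarith
      qed (use v1' v3 in \<open>simp_all add: pqc(3)\<close>)
    next
      case 7
      have x: "a ^ i = a * M" using 7 by (simp add: M_def)
      have y: "a ^ j < M" using 7 a1 unfolding M_def by (intro power_strict_increasing) auto
      define p q c where pqc: "p = - (M - 1)" "q = - (a * M * (a - 1))" "c = - q - p * (a * (a * M))"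
      have p: "p < 0" and q: "q < 0" using pos unfolding pqc by simp_all
      have v1: "p + q * (a * (a * M)) + c = - ((a * (a * M) - 1) * (M * (a\<^sup>2 - a - 1) + 1))"
        and v3: "p * M + q * (a * M) + c = - (M * (a - 1) * (M * (a\<^sup>2 - a - 1) + 1))"
        and v4: "p * (a * M) + q * M + c = 0"
        unfolding pqc by (simp_all add: algebra_simps power2_eq_square)
      have "(a * (a * M) - 1) * (M * (a\<^sup>2 - a - 1) + 1) > 0" "M * (a - 1) * (M * (a\<^sup>2 - a - 1) + 1) > 0"
        using pos by (intro mult_pos_pos golden_pos; simp)+
      then have v1': "p + q * (a * (a * M)) + c \<le> 0" and v3': "p * M + q * (a * M) + c \<le> 0"
        using v1 v3 by linarith+
      show ?thesis unfolding x
      proof (rule sepI[where p = p and q = q and c = c])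
        show "p * (a * M) + q * a ^ j + c > 0"
          using mult_strict_left_mono_neg[OF y q] v4 by linarith
        have "p * a \<le> p" using p a1 by simp
        then show "a * M = a \<and> a ^ j = a * (a * M) \<or> p * a + q * (a * (a * M)) + c \<le> 0"
          using v1' by linarith
        have "q * (a * M) \<le> q * M" using q aM by simp
        then show "a * M = a * M \<and> a ^ j = a * M \<or> p * (a * M) + q * (a * M) + c \<le> 0"
          using v4 by linarith
        have "q * a \<le> q" using q a1 by simp
        then show "a * M = a * (a * M) \<and> a ^ j = a \<or> p * (a * (a * M)) + q * a + c \<le> 0"
          unfolding pqc(3) by linarith
      qed (use v1' v3' v4 in \<open>simp_all add: pqc(3)\<close>)
    next
      case 8
      have xy: "a ^ i \<le> M" "a ^ j \<le> M" using 8 a1 unfolding M_def by (auto intro: power_increasing)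
      \<comment> \<open>By the golden ratio bound the vertices in row \<open>m + 2\<close> lie
        beyond the line through \<open>(M, a * M)\<close> and \<open>(a * M, M)\<close>.\<close>
      have le: "a * M + M \<le> a * (a * M)"
        using golden_M by (simp add: algebra_simps power2_eq_square)
      show ?thesis
      proof (rule sepI[where p = "-1" and q = "-1" and c = "a * M + M"])
        show "- 1 * a ^ i + - 1 * a ^ j + (a * M + M) > 0" using xy aM(1) by linarith
      qed (rule disjI2, use le aM(1) a1 in linarith)+
    qed
  qed
  have "prod.swap ` W = W" unfolding W_def by auto
  then have "h (exp_lattice a) \<ge> enat (card W)"
    by (intro h_ge[OF _ sub _ _ sep_le]) (use card in \<open>auto simp: W_def\<close>)
  then show ?thesis unfolding card by (simp add: numeral_eq_enat)
qed

theorem corollary4: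
  shows "(\<forall>\<alpha>::real. \<alpha> \<ge> 2 \<longrightarrow> h (exp_lattice \<alpha>) = 5) \<and>
         (\<forall>\<alpha>::real. \<alpha> \<in> {(1 + sqrt 5) / 2 ..< 2} \<longrightarrow> h (exp_lattice \<alpha>) = 7)"
proof (intro conjI allI impI)
  fix \<alpha> :: real
  assume \<alpha>: "\<alpha> \<ge> 2"
  \<comment> \<open>For \<open>K = 1\<close> the assumption reduces to
    \<open>\<alpha> - 1 \<ge> 1\<close>.\<close>
  then interpret exp_chain \<alpha> 1
    using mult_left_mono[of 1 "\<alpha> - 1" \<alpha>] by unfold_locales simp_all
  have "h (exp_lattice \<alpha>) \<le> 5" using h_le by (simp add: numeral_eq_enat)
  then show "h (exp_lattice \<alpha>) = 5" using pentagon[OF base_gt_1] by (rule antisym)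
next
  fix \<alpha> :: real
  assume \<alpha>: "\<alpha> \<in> {(1 + sqrt 5) / 2 ..< 2}"
  have "1 < (1 + sqrt 5) / 2" by simp
  also have "\<dots> \<le> \<alpha>" using \<alpha> by simp
  finally have "\<alpha> > 1" .
  have "sqrt 5 \<le> 2 * \<alpha> - 1" using \<alpha> by (simp add: field_simps)
  then have "(sqrt 5)\<^sup>2 \<le> (2 * \<alpha> - 1)\<^sup>2" by (rule power_mono) simp
  then have golden: "\<alpha> + 1 \<le> \<alpha>\<^sup>2" by (simp add: power2_eq_square algebra_simps)
  \<comment> \<open>Multiplying \<open>1 \<le> \<alpha> * (\<alpha> - 1)\<close> by
    \<open>\<alpha>\<close> gives the assumption for \<open>K = 2\<close>.\<close>
  then have "\<alpha> * 1 \<le> \<alpha> * (\<alpha> * (\<alpha> - 1))"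
    using \<open>\<alpha> > 1\<close> by (intro mult_left_mono) (simp_all add: algebra_simps power2_eq_square)
  then interpret exp_chain \<alpha> 2
    using \<open>\<alpha> > 1\<close> by unfold_locales (simp_all add: power2_eq_square)
  have "h (exp_lattice \<alpha>) \<le> 7" using h_le by (simp add: numeral_eq_enat)
  then show "h (exp_lattice \<alpha>) = 7" using heptagon \<alpha> golden base_gt_1 by (intro antisym) auto
qed

end
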